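(* Let $f: Y \to X$ be a fibration in a path category $\mathcal{C}$, and assume that $PX$ is a path object on $X$ and $\Gamma: Y \times_X PX \to Y$ is a transport structure on $f$. Then there exist a path object $PY$ on $Y$ and a fibration $Pf: PY \to PX$ with the following properties: (i) $Pf$ commutes with the $r$-, $s$- and $t$-maps on $PX$ and $PY$, i.e. $Pf \circ r_Y = r_X \circ f$, $s_X \circ Pf = f \circ s_Y$ and $t_X \circ Pf = f \circ t_Y$; (ii) there exists a connection structure $\nabla: P_f \to PY$ (that is, a map with $Pf \circ \nabla = p_2$ and $s_Y \nabla = p_1$) such that $t_Y\nabla = \Gamma$. In particular, every fibration $f: Y \to X$ in a path category carries a connection structure.
   Context: A path category is a category $\mathcal{C}$ with two classes of maps, fibrations and weak equivalences (maps in both classes are called acyclic fibrations), such that: (1) fibrations are closed under composition; (2) the pullback of a fibration along any map exists and is a fibration; (3) the pullback of an acyclic fibration along any map is an acyclic fibration; (4) 2-out-of-6: if $f:A\to B$, $g:B\to C$, $h:C\to D$ and $gf$, $hg$ are weak equivalences, then so are $f,g,h,hgf$; (5) isomorphisms are acyclic fibrations and every acyclic fibration has a section; (6) every object $B$ has a path object, i.e. a factorisation of the diagonal $B \to B\times B$ as a weak equivalence $r: B \to PB$ followed by a fibration $(s,t): PB \to B \times B$; (7) there is a terminal object $1$ and every map $X \to 1$ is a fibration. For an object $A$, $\mathcal{C}(A)$ is the full subcategory of $\mathcal{C}/A$ on the fibrations with codomain $A$, with fibrations and weak equivalences as in $\mathcal{C}$; it is again a path category. If $p: X \to I$ is a fibration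 and $f, g: Y \to X$ satisfy $pf = pg$, then $f$ and $g$ are fibrewise homotopic over $I$, written $f \simeq_I g$, if for a path object $(s,t): P_I(X) \to X \times_I X$ of $X$ in $\mathcal{C}(I)$ there is $h: Y \to P_I(X)$ with $sh = f$ and $th = g$. Given $f: Y \to X$ and a path object $PX$, let $P_f = Y \times_X PX$ be the pullback of $f$ and $s: PX \to X$, with projections $p_1: P_f \to Y$ and $p_2: P_f \to PX$. Put $w_f := (1_Y, rf): Y \to P_f$ and $p_f := t p_2: P_f \to X$. A transport structure on a fibration $f: Y \to X$ is a map $\Gamma: P_f \to Y$ with $f\Gamma = p_f$ and $\Gamma w_f \simeq_X 1_Y$ (fibrewise homotopy with respect to $f: Y\to X$). A connection on a fibration $f: Y \to X$ consists of a path object $PY$ for $Y$, a fibration $Pf: PY \to PX$ commuting with the $r$-, $s$- and $t$-maps on $PX$ and $PY$, and a map $\nabla: P_f \to PY$ with $Pf \circ \nabla = p_2$ and $s\nabla = p_1$. *)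

theory Defs
  imports Main
begin

section \<open>Categories\<close>

text \<open>
  A category has a set of objects and a set of arrows inside two carrier types. The operations are
  only constrained on these sets, and \<open>g \<cdot> f\<close> (first \<open>f\<close>, then \<open>g\<close>) only when \<open>cod f = dom g\<close>.
\<close>

record ('o, 'm) cat_data =
  Obj :: "'o set"
  Arr :: "'m set"
  Dom :: "'m \<Rightarrow> 'o"
  Cod :: "'m \<Rightarrow> 'o"
  Idt :: "'o \<Rightarrow> 'm"
  Comp :: "'m \<Rightarrow> 'm \<Rightarrow> 'm" (infixr "\<cdot>\<index>" 70)

definition hom :: "('o, 'm, 'z) cat_data_scheme \<Rightarrow> 'o \<Rightarrow> 'o \<Rightarrow> 'm set" where
  "hom C A B = {f \<in> Arr C. Dom C f = A \<and> Cod C f = B}"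

locale category =
  fixes C :: "('o, 'm, 'z) cat_data_scheme" (structure)
  assumes dom_obj: "f \<in> Arr C \<Longrightarrow> Dom C f \<in> Obj C"
    and cod_obj: "f \<in> Arr C \<Longrightarrow> Cod C f \<in> Obj C"
    and id_hom: "A \<in> Obj C \<Longrightarrow> Idt C A \<in> hom C A A"
    and comp_hom: "\<lbrakk>f \<in> hom C A B; g \<in> hom C B D\<rbrakk> \<Longrightarrow> g \<cdot> f \<in> hom C A D"
    and id_left: "f \<in> hom C A B \<Longrightarrow> Idt C B \<cdot> f = f"
    and id_right: "f \<in> hom C A B \<Longrightarrow> f \<cdot> Idt C A = f"
    and comp_assoc: "\<lbrakk>f \<in> hom C A B; g \<in> hom C B D; h \<in> hom C D E\<rbrakk>
          \<Longrightarrow> (h \<cdot> g) \<cdot> f = h \<cdot> (g \<cdot> f)"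

definition is_iso :: "('o, 'm, 'z) cat_data_scheme \<Rightarrow> 'm \<Rightarrow> bool" where
  "is_iso C f \<longleftrightarrow> f \<in> Arr C \<and>
     (\<exists>g \<in> hom C (Cod C f) (Dom C f).
        g \<cdot>\<^bsub>C\<^esub> f = Idt C (Dom C f) \<and> f \<cdot>\<^bsub>C\<^esub> g = Idt C (Cod C f))"

definition is_terminal :: "('o, 'm, 'z) cat_data_scheme \<Rightarrow> 'o \<Rightarrow> bool" where
  "is_terminal C T \<longleftrightarrow> T \<in> Obj C \<and> (\<forall>X \<in> Obj C. \<exists>!u. u \<in> hom C X T)"

definition is_product ::
  "('o, 'm, 'z) cat_data_scheme \<Rightarrow> 'o \<Rightarrow> 'o \<Rightarrow> 'o \<Rightarrow> 'm \<Rightarrow> 'm \<Rightarrow> bool" where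
  "is_product C A B Q q1 q2 \<longleftrightarrow> q1 \<in> hom C Q A \<and> q2 \<in> hom C Q B \<and>
     (\<forall>Z. \<forall>u \<in> hom C Z A. \<forall>v \<in> hom C Z B.
        \<exists>!w. w \<in> hom C Z Q \<and> q1 \<cdot>\<^bsub>C\<^esub> w = u \<and> q2 \<cdot>\<^bsub>C\<^esub> w = v)"

definition is_pullback ::
  "('o, 'm, 'z) cat_data_scheme \<Rightarrow> 'm \<Rightarrow> 'm \<Rightarrow> 'o \<Rightarrow> 'm \<Rightarrow> 'm \<Rightarrow> bool" where
  "is_pullback C f g P p1 p2 \<longleftrightarrow>
     f \<in> Arr C \<and> g \<in> Arr C \<and> Cod C f = Cod C g \<and>
     p1 \<in> hom C P (Dom C f) \<and> p2 \<in> hom C P (Dom C g) \<and> f \<cdot>\<^bsub>C\<^esub> p1 = g \<cdot>\<^bsub>C\<^esub> p2 \<and>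
     (\<forall>Z. \<forall>u \<in> hom C Z (Dom C f). \<forall>v \<in> hom C Z (Dom C g). f \<cdot>\<^bsub>C\<^esub> u = g \<cdot>\<^bsub>C\<^esub> v \<longrightarrow>
        (\<exists>!w. w \<in> hom C Z P \<and> p1 \<cdot>\<^bsub>C\<^esub> w = u \<and> p2 \<cdot>\<^bsub>C\<^esub> w = v))"

text \<open>The map \<open>(u, v)\<close> into a pullback \<open>P\<close> with projections \<open>p1\<close> and \<open>p2\<close>.\<close>

definition pb_pair ::
  "('o, 'm, 'z) cat_data_scheme \<Rightarrow> 'o \<Rightarrow> 'm \<Rightarrow> 'm \<Rightarrow> 'm \<Rightarrow> 'm \<Rightarrow> 'm" where
  "pb_pair C P p1 p2 u v =
     (THE w. w \<in> hom C (Dom C u) P \<and> p1 \<cdot>\<^bsub>C\<^esub> w = u \<and> p2 \<cdot>\<^bsub>C\<^esub> w = v)"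


section \<open>Path categories\<close>

record ('o, 'm) path_cat_data = "('o, 'm) cat_data" +
  Fib :: "'m set"
  Weq :: "'m set"

text \<open>
  A path object \<open>PB\<close> on \<open>B\<close>: the equations for \<open>s \<cdot> r\<close> and \<open>t \<cdot> r\<close> say that \<open>(s, t) \<cdot> r\<close> is the
  diagonal, and \<open>st\<close> is the map \<open>(s, t)\<close> into a product \<open>B \<times> B\<close>. The choice of product is immaterial
  in a path category, where isomorphisms are fibrations.
\<close>

definition path_object ::
  "('o, 'm, 'z) path_cat_data_scheme \<Rightarrow> 'o \<Rightarrow> 'o \<Rightarrow> 'm \<Rightarrow> 'm \<Rightarrow> 'm \<Rightarrow> bool" where
  "path_object C B PB r s t \<longleftrightarrow>
     r \<in> hom C B PB \<and> r \<in> Weq C \<and> s \<in> hom C PB B \<and> t \<in> hom C PB B \<and>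
     s \<cdot>\<^bsub>C\<^esub> r = Idt C B \<and> t \<cdot>\<^bsub>C\<^esub> r = Idt C B \<and>
     (\<exists>Q q1 q2 st. is_product C B B Q q1 q2 \<and> st \<in> hom C PB Q \<and> st \<in> Fib C \<and>
        q1 \<cdot>\<^bsub>C\<^esub> st = s \<and> q2 \<cdot>\<^bsub>C\<^esub> st = t)"

locale path_category = category C
  for C :: "('o, 'm, 'z) path_cat_data_scheme" (structure) +
  assumes fib_arr: "Fib C \<subseteq> Arr C"
    and weq_arr: "Weq C \<subseteq> Arr C"
    and fib_comp: "\<lbrakk>f \<in> Fib C; g \<in> Fib C; Cod C f = Dom C g\<rbrakk> \<Longrightarrow> g \<cdot> f \<in> Fib C"
    and fib_pullback_ex: "\<lbrakk>p \<in> Fib C; f \<in> Arr C; Cod C f = Cod C p\<rbrakk>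
          \<Longrightarrow> \<exists>P p1 p2. is_pullback C p f P p1 p2"
    and fib_pullback: "\<lbrakk>p \<in> Fib C; is_pullback C p f P p1 p2\<rbrakk> \<Longrightarrow> p2 \<in> Fib C"
    and acyclic_fib_pullback: "\<lbrakk>p \<in> Fib C \<inter> Weq C; is_pullback C p f P p1 p2\<rbrakk>
          \<Longrightarrow> p2 \<in> Fib C \<inter> Weq C"
    and two_out_of_six: "\<lbrakk>f \<in> hom C A B; g \<in> hom C B D; h \<in> hom C D E; g \<cdot> f \<in> Weq C; h \<cdot> g \<in> Weq C\<rbrakk>
          \<Longrightarrow> f \<in> Weq C \<and> g \<in> Weq C \<and> h \<in> Weq C \<and> h \<cdot> (g \<cdot> f) \<in> Weq C"
    and iso_acyclic_fib: "is_iso C f \<Longrightarrow> f \<in> Fib C \<inter> Weq C"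
    and acyclic_fib_section: "f \<in> Fib C \<inter> Weq C
          \<Longrightarrow> \<exists>g \<in> hom C (Cod C f) (Dom C f). f \<cdot> g = Idt C (Cod C f)"
    and path_object_ex: "B \<in> Obj C \<Longrightarrow> \<exists>PB r s t. path_object C B PB r s t"
    and terminal_fib: "\<exists>T. is_terminal C T \<and> (\<forall>X \<in> Obj C. hom C X T \<subseteq> Fib C)"


section \<open>Fibrewise homotopy\<close>

text \<open>
  The category \<open>C(A)\<close> of fibrations over \<open>A\<close>. An object is a fibration \<open>p\<close> with codomain \<open>A\<close>, and
  \<open>(p, u, q)\<close> is the arrow from \<open>p\<close> to \<open>q\<close> given by an arrow \<open>u\<close> of \<open>C\<close> with \<open>q \<cdot> u = p\<close>.
\<close>

definition slice_arr :: "('o, 'm, 'z) path_cat_data_scheme \<Rightarrow> 'o \<Rightarrow> ('m \<times> 'm \<times> 'm) set" where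
  "slice_arr C A = {(p, u, q). p \<in> Fib C \<and> Cod C p = A \<and> q \<in> Fib C \<and> Cod C q = A \<and>
     u \<in> hom C (Dom C p) (Dom C q) \<and> q \<cdot>\<^bsub>C\<^esub> u = p}"

definition slice ::
  "('o, 'm, 'z) path_cat_data_scheme \<Rightarrow> 'o \<Rightarrow> ('m, 'm \<times> 'm \<times> 'm) path_cat_data" where
  "slice C A =
     \<lparr> Obj = {p \<in> Fib C. Cod C p = A},
       Arr = slice_arr C A,
       Dom = (\<lambda>(p, u, q). p),
       Cod = (\<lambda>(p, u, q). q),
       Idt = (\<lambda>p. (p, Idt C (Dom C p), p)),
       Comp = (\<lambda>(p', v, q') (p, u, q). (p, v \<cdot>\<^bsub>C\<^esub> u, q')),
       Fib = {(p, u, q) \<in> slice_arr C A. u \<in> Fib C},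
       Weq = {(p, u, q) \<in> slice_arr C A. u \<in> Weq C} \<rparr>"

text \<open>
  \<open>f \<simeq>\<^sub>I g\<close> with respect to a fibration \<open>p : X \<rightarrow> I\<close>. The path object of \<open>p\<close> in \<open>C(I)\<close> is \<open>q\<close>, so that
  \<open>Dom C q\<close> is the object \<open>P\<^sub>I(X)\<close> of \<open>C\<close>. The homotopy \<open>h\<close> is an arrow of \<open>C\<close>, as the
  composite \<open>p \<cdot> f\<close> need not be a fibration.
\<close>

definition fibrewise_homotopic ::
  "('o, 'm, 'z) path_cat_data_scheme \<Rightarrow> 'm \<Rightarrow> 'm \<Rightarrow> 'm \<Rightarrow> bool" where
  "fibrewise_homotopic C p f g \<longleftrightarrow>
     p \<in> Fib C \<and> f \<in> hom C (Dom C f) (Dom C p) \<and> g \<in> hom C (Dom C f) (Dom C p) \<and>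
     p \<cdot>\<^bsub>C\<^esub> f = p \<cdot>\<^bsub>C\<^esub> g \<and>
     (\<exists>q r s t. path_object (slice C (Cod C p)) p q (p, r, q) (q, s, p) (q, t, p) \<and>
        (\<exists>h \<in> hom C (Dom C f) (Dom C q). s \<cdot>\<^bsub>C\<^esub> h = f \<and> t \<cdot>\<^bsub>C\<^esub> h = g))"


section \<open>Transport structures and connections\<close>

text \<open>
  In what follows \<open>f : Y \<rightarrow> X\<close>, the path object on \<open>X\<close> is \<open>(PX, rX, sX, tX)\<close>, and \<open>M\<close> with
  projections \<open>p1 : M \<rightarrow> Y\<close> and \<open>p2 : M \<rightarrow> PX\<close> is a pullback of \<open>f\<close> and \<open>sX\<close>: the mapping path object
  usually written \<open>P\<^sub>f\<close>. It is not to be confused with the fibration \<open>Pf : PY \<rightarrow> PX\<close> of a connection.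
\<close>

definition w_map ::
  "('o, 'm, 'z) path_cat_data_scheme \<Rightarrow> 'm \<Rightarrow> 'm \<Rightarrow> 'o \<Rightarrow> 'm \<Rightarrow> 'm \<Rightarrow> 'm" where
  "w_map C f rX M p1 p2 = pb_pair C M p1 p2 (Idt C (Dom C f)) (rX \<cdot>\<^bsub>C\<^esub> f)"

definition p_map :: "('o, 'm, 'z) path_cat_data_scheme \<Rightarrow> 'm \<Rightarrow> 'm \<Rightarrow> 'm" where
  "p_map C tX p2 = tX \<cdot>\<^bsub>C\<^esub> p2"

definition transport_structure ::
  "('o, 'm, 'z) path_cat_data_scheme \<Rightarrow> 'm \<Rightarrow> 'm \<Rightarrow> 'm \<Rightarrow> 'o \<Rightarrow> 'm \<Rightarrow> 'm \<Rightarrow> 'm \<Rightarrow> bool" where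
  "transport_structure C f rX tX M p1 p2 \<Gamma> \<longleftrightarrow>
     \<Gamma> \<in> hom C M (Dom C f) \<and> f \<cdot>\<^bsub>C\<^esub> \<Gamma> = p_map C tX p2 \<and>
     fibrewise_homotopic C f (\<Gamma> \<cdot>\<^bsub>C\<^esub> w_map C f rX M p1 p2) (Idt C (Dom C f))"

definition is_connection ::
  "('o, 'm, 'z) path_cat_data_scheme \<Rightarrow> 'm \<Rightarrow> 'o \<Rightarrow> 'm \<Rightarrow> 'm \<Rightarrow> 'm \<Rightarrow> 'o \<Rightarrow> 'm \<Rightarrow> 'm
     \<Rightarrow> 'o \<Rightarrow> 'm \<Rightarrow> 'm \<Rightarrow> 'm \<Rightarrow> 'm \<Rightarrow> 'm \<Rightarrow> bool" where
  "is_connection C f PX rX sX tX M p1 p2 PY rY sY tY Pf N \<longleftrightarrow>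
     path_object C (Dom C f) PY rY sY tY \<and>
     Pf \<in> hom C PY PX \<and> Pf \<in> Fib C \<and>
     Pf \<cdot>\<^bsub>C\<^esub> rY = rX \<cdot>\<^bsub>C\<^esub> f \<and> sX \<cdot>\<^bsub>C\<^esub> Pf = f \<cdot>\<^bsub>C\<^esub> sY \<and> tX \<cdot>\<^bsub>C\<^esub> Pf = f \<cdot>\<^bsub>C\<^esub> tY \<and>
     N \<in> hom C M PY \<and> Pf \<cdot>\<^bsub>C\<^esub> N = p2 \<and> sY \<cdot>\<^bsub>C\<^esub> N = p1"

end

theory Submission
  imports Defs
begin

text \<open>Read \<open>M\<close> as the object of pairs (y, \<alpha>) of a point of
  \<open>Y\<close> and a path in \<open>X\<close> starting at its image under \<open>f\<close>. A
  transport structure sends such a pair to a point over the end of \<alpha>, and its homotopy h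
  joins the transport of y along the constant path to y itself, within the fibre. So a path in
  \<open>Y\<close> over \<alpha> from y to y' can be taken to be a fibrewise path from \<Gamma>(y,
  \<alpha>) to y': \<open>PY\<close> is the pullback of \<Gamma> along the source map of the
  fibrewise path object of \<open>Y\<close> (\<open>connection_of_transport\<close>). The connection
  pairs (y, \<alpha>) with the constant fibrewise path at \<Gamma>(y, \<alpha>), so its endpoint is
  \<Gamma>. Reflexivity pairs the constant path in \<open>X\<close> with h.

  \<open>PY\<close> is a path object for two reasons. Its source map is the composite of the acyclic
  fibrations from \<open>PY\<close> to \<open>M\<close> and from \<open>M\<close> to
  \<open>Y\<close>, and reflexivity is a section of this composite, hence a weak equivalence. The
  endpoint map factors through the fibre product of \<open>M\<close> and \<open>Y\<close> over
  \<open>X\<close>: the first factor is a base change of the endpoint map of the fibrewise path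
  object, the second a base change of the fibration from \<open>M\<close> to Y \<times> X given by
  the start in \<open>Y\<close> and the end in \<open>X\<close>.

  For an arbitrary fibration it remains to find a transport structure. The map w from
  \<open>Y\<close> to \<open>M\<close> is a weak equivalence between fibrations over
  \<open>X\<close>, and such a map has a retraction over \<open>X\<close> up to fibrewise homotopy
  (\<open>weq_retraction_up_to_homotopy\<close>); this retraction is \<Gamma>
  (\<open>transport_structure_ex\<close>).

  Fibrations into fibre products are handled by \<open>span_fib\<close>, which is stable under base
  change, composition and postcomposition with a fibration.\<close>

context category
begin

section \<open>Pullbacks and products in a category\<close>

lemma homD:
  assumes "f \<in> hom C A B"
  shows "f \<in> Arr C" "Dom C f = A" "Cod C f = B" "A \<in> Obj C" "B \<in> Obj C"
  using assms by (auto simp: hom_def intro: dom_obj cod_obj)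

lemma pullbackI:
  assumes "f \<in> hom C A I" "g \<in> hom C B I" "p1 \<in> hom C P A" "p2 \<in> hom C P B"
    and "f \<cdot> p1 = g \<cdot> p2"
    and "\<And>Z u v. \<lbrakk>u \<in> hom C Z A; v \<in> hom C Z B; f \<cdot> u = g \<cdot> v\<rbrakk>
          \<Longrightarrow> \<exists>w \<in> hom C Z P. p1 \<cdot> w = u \<and> p2 \<cdot> w = v"
    and "\<And>Z w w'. \<lbrakk>w \<in> hom C Z P; w' \<in> hom C Z P; p1 \<cdot> w = p1 \<cdot> w'; p2 \<cdot> w = p2 \<cdot> w'\<rbrakk> \<Longrightarrow> w = w'"
  shows "is_pullback C f g P p1 p2"
  unfolding is_pullback_def homD[OF assms(1)] homD[OF assms(2)]
proof (intro conjI allI ballI impI)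
  fix Z u v
  assume "u \<in> hom C Z A" "v \<in> hom C Z B" "f \<cdot> u = g \<cdot> v"
  then obtain w where "w \<in> hom C Z P" "p1 \<cdot> w = u" "p2 \<cdot> w = v" using assms(6) by blast
  then show "\<exists>!w. w \<in> hom C Z P \<and> p1 \<cdot> w = u \<and> p2 \<cdot> w = v"
    by (intro ex1I[of _ w]) (auto intro: assms(7))
qed (use assms(1-5) in \<open>auto simp: hom_def\<close>)

lemma pullbackD:
  assumes "is_pullback C f g P p1 p2" "f \<in> hom C A I"
  shows "p1 \<in> hom C P A" "g \<in> hom C (Dom C g) I" "p2 \<in> hom C P (Dom C g)" "f \<cdot> p1 = g \<cdot> p2"
  using assms by (auto simp: is_pullback_def hom_def)

lemma pullback_pair_ex:
  assumes "is_pullback C f g P p1 p2" "f \<in> hom C A I" "g \<in> hom C B I"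
    and "u \<in> hom C Z A" "v \<in> hom C Z B" "f \<cdot> u = g \<cdot> v"
  shows "\<exists>w \<in> hom C Z P. p1 \<cdot> w = u \<and> p2 \<cdot> w = v"
  using assms homD(2)[OF assms(2)] homD(2)[OF assms(3)] unfolding is_pullback_def by metis

lemma pullback_pair_eq:
  assumes "is_pullback C f g P p1 p2"
    and "w \<in> hom C Z P" "w' \<in> hom C Z P" "p1 \<cdot> w = p1 \<cdot> w'" "p2 \<cdot> w = p2 \<cdot> w'"
  shows "w = w'"
proof -
  have p: "f \<in> hom C (Dom C f) (Cod C f)" "g \<in> hom C (Dom C g) (Cod C f)"
    "p1 \<in> hom C P (Dom C f)" "p2 \<in> hom C P (Dom C g)" "f \<cdot> p1 = g \<cdot> p2"
    using assms(1) by (auto simp: is_pullback_def hom_def)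
  have "f \<cdot> (p1 \<cdot> w) = g \<cdot> (p2 \<cdot> w)"
    using comp_assoc[OF assms(2) p(3,1)] comp_assoc[OF assms(2) p(4,2)] p(5) by simp
  then show ?thesis
    using assms comp_hom[OF assms(2) p(3)] comp_hom[OF assms(2) p(4)]
    unfolding is_pullback_def by metis
qed

lemma pullback_sym:
  assumes "is_pullback C f g P p1 p2"
  shows "is_pullback C g f P p2 p1"
proof -
  note A = assms[unfolded is_pullback_def]
  show ?thesis
    unfolding is_pullback_def
  proof (intro conjI allI ballI impI)
    fix Z u v
    assume "u \<in> hom C Z (Dom C g)" "v \<in> hom C Z (Dom C f)" "g \<cdot> u = f \<cdot> v"
    then have "\<exists>!w. w \<in> hom C Z P \<and> p1 \<cdot> w = v \<and> p2 \<cdot> w = u"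
      using A by simp
    then show "\<exists>!w. w \<in> hom C Z P \<and> p2 \<cdot> w = u \<and> p1 \<cdot> w = v"
      by (simp add: conj_commute)
  qed (use A in auto)
qed

lemma pb_pair_props:
  assumes "is_pullback C f g P p1 p2" "f \<in> hom C A I" "g \<in> hom C B I"
    and "u \<in> hom C Z A" "v \<in> hom C Z B" "f \<cdot> u = g \<cdot> v"
  shows "pb_pair C P p1 p2 u v \<in> hom C Z P"
    and "p1 \<cdot> pb_pair C P p1 p2 u v = u" and "p2 \<cdot> pb_pair C P p1 p2 u v = v"
proof -
  have "\<exists>!w. w \<in> hom C (Dom C u) P \<and> p1 \<cdot> w = u \<and> p2 \<cdot> w = v"
    using pullback_pair_ex[OF assms] pullback_pair_eq[OF assms(1)] homD(2)[OF assms(4)] by metis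
  from theI'[OF this] show "pb_pair C P p1 p2 u v \<in> hom C Z P"
    and "p1 \<cdot> pb_pair C P p1 p2 u v = u" and "p2 \<cdot> pb_pair C P p1 p2 u v = v"
    unfolding pb_pair_def using homD(2)[OF assms(4)] by auto
qed

text \<open>Any two maps into a terminal object agree, so the commutation condition of the pullback
  is vacuous. Path objects in C thereby become an instance of spans over a base.\<close>

lemma product_iff_pullback:
  assumes "is_terminal C T" "a \<in> hom C A T" "b \<in> hom C B T"
  shows "is_product C A B Q q1 q2 \<longleftrightarrow> is_pullback C a b Q q1 q2"
proof -
  have "a \<cdot> u = b \<cdot> v" if "u \<in> hom C Z A" "v \<in> hom C Z B" for Z u v
    using assms(1) comp_hom[OF that(1) assms(2)] comp_hom[OF that(2) assms(3)] homD(4)[OF that(1)]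
    unfolding is_terminal_def by blast
  then show ?thesis
    unfolding is_product_def is_pullback_def homD[OF assms(2)] homD[OF assms(3)]
    using homD(1)[OF assms(2)] homD(1)[OF assms(3)] by blast
qed

text \<open>Serves to replace the unspecified product in a path object of C(X) by the fibre product
  over \<open>X\<close>.\<close>

lemma product_iso:
  assumes P: "is_product C A B P p1 p2" and Q: "is_product C A B Q q1 q2"
  shows "\<exists>i \<in> hom C P Q. \<exists>j \<in> hom C Q P. j \<cdot> i = Idt C P \<and> i \<cdot> j = Idt C Q \<and>
    q1 \<cdot> i = p1 \<and> q2 \<cdot> i = p2"
proof -
  have p: "p1 \<in> hom C P A" "p2 \<in> hom C P B" and q: "q1 \<in> hom C Q A" "q2 \<in> hom C Q B"
    using P Q by (auto simp: is_product_def)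
  obtain i where i: "i \<in> hom C P Q" "q1 \<cdot> i = p1" "q2 \<cdot> i = p2"
    using Q p unfolding is_product_def by blast
  obtain j where j: "j \<in> hom C Q P" "p1 \<cdot> j = q1" "p2 \<cdot> j = q2"
    using P q unfolding is_product_def by blast
  have "\<exists>!w. w \<in> hom C P P \<and> p1 \<cdot> w = p1 \<and> p2 \<cdot> w = p2"
    using P p unfolding is_product_def by blast
  moreover have "j \<cdot> i \<in> hom C P P \<and> p1 \<cdot> (j \<cdot> i) = p1 \<and> p2 \<cdot> (j \<cdot> i) = p2"
    using i j comp_hom[OF i(1) j(1)] comp_assoc[OF i(1) j(1) p(1)] comp_assoc[OF i(1) j(1) p(2)]
    by simp
  moreover have "Idt C P \<in> hom C P P \<and> p1 \<cdot> Idt C P = p1 \<and> p2 \<cdot> Idt C P = p2"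
    using id_hom id_right p homD(4) by blast
  ultimately have ji: "j \<cdot> i = Idt C P" by blast
  have "\<exists>!w. w \<in> hom C Q Q \<and> q1 \<cdot> w = q1 \<and> q2 \<cdot> w = q2"
    using Q q unfolding is_product_def by blast
  moreover have "i \<cdot> j \<in> hom C Q Q \<and> q1 \<cdot> (i \<cdot> j) = q1 \<and> q2 \<cdot> (i \<cdot> j) = q2"
    using i j comp_hom[OF j(1) i(1)] comp_assoc[OF j(1) i(1) q(1)] comp_assoc[OF j(1) i(1) q(2)]
    by simp
  moreover have "Idt C Q \<in> hom C Q Q \<and> q1 \<cdot> Idt C Q = q1 \<and> q2 \<cdot> Idt C Q = q2"
    using id_hom id_right q homD(4) by blast
  ultimately have "i \<cdot> j = Idt C Q" by blast
  with ji i j show ?thesis by blast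
qed

end

context path_category
begin

section \<open>Weak equivalences\<close>

lemma id_iso: "A \<in> Obj C \<Longrightarrow> is_iso C (Idt C A)"
  using id_hom[of A] id_left[OF id_hom, of A] homD[OF id_hom, of A] by (auto simp: is_iso_def)

lemma id_weq: "A \<in> Obj C \<Longrightarrow> Idt C A \<in> Weq C"
  using iso_acyclic_fib id_iso by blast+

text \<open>This and the two cancellation laws are 2-out-of-6 with an identity put in the middle,
  first and last place respectively.\<close>

lemma weq_comp:
  assumes "f \<in> hom C A B" "g \<in> hom C B D" "f \<in> Weq C" "g \<in> Weq C"
  shows "g \<cdot> f \<in> Weq C"
  using two_out_of_six[OF assms(1) id_hom assms(2)] id_left[OF assms(1)] id_right[OF assms(2)]
    assms homD[OF assms(1)] homD[OF assms(2)] by simp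

lemma weq_cancel_right:
  assumes "f \<in> hom C A B" "g \<in> hom C B D" "g \<cdot> f \<in> Weq C" "f \<in> Weq C"
  shows "g \<in> Weq C"
  using two_out_of_six[OF id_hom assms(1,2)] id_right[OF assms(1)]
    assms homD[OF assms(1)] homD[OF assms(2)] by simp

lemma weq_cancel_left:
  assumes "f \<in> hom C A B" "g \<in> hom C B D" "g \<cdot> f \<in> Weq C" "g \<in> Weq C"
  shows "f \<in> Weq C"
  using two_out_of_six[OF assms(1,2) id_hom] id_left[OF assms(2)]
    assms homD[OF assms(1)] homD[OF assms(2)] by simp

lemma retraction_weq:
  assumes "r \<in> hom C A B" "s \<in> hom C B A" "s \<cdot> r = Idt C A" "r \<in> Weq C"
  shows "s \<in> Weq C"
  using weq_cancel_right[OF assms(1,2)] assms id_weq[OF homD(4)[OF assms(1)]] by simp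

lemma section_weq:
  assumes "r \<in> hom C A B" "s \<in> hom C B A" "s \<cdot> r = Idt C A" "s \<in> Weq C"
  shows "r \<in> Weq C"
  using weq_cancel_left[OF assms(1,2)] assms id_weq[OF homD(4)[OF assms(1)]] by simp

lemma fib_comp_hom:
  assumes "f \<in> hom C A B" "g \<in> hom C B D" "f \<in> Fib C" "g \<in> Fib C"
  shows "g \<cdot> f \<in> Fib C"
  using fib_comp
    assms homD[OF assms(1)] homD[OF assms(2)] by simp

lemma pullback_ex:
  assumes "p \<in> hom C A I" "f \<in> hom C B I" "p \<in> Fib C"
  shows "\<exists>P p1 p2. is_pullback C p f P p1 p2"
  using fib_pullback_ex[OF assms(3), of f] homD[OF assms(1)] homD[OF assms(2)] by simp

section \<open>Fibrations into fibre products\<close>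

text \<open>
  \<open>(a, b) : M \<rightarrow> A \<times>\<^sub>I B\<close> is a fibration, where \<open>c : A \<rightarrow> I\<close> and \<open>d : B \<rightarrow> I\<close>. Path objects of \<open>C\<close> are the
  case that \<open>I\<close> is terminal, and path objects of \<open>C(I)\<close> the case that \<open>c\<close> and \<open>d\<close> are equal.
\<close>

definition span_fib :: "'m \<Rightarrow> 'm \<Rightarrow> 'o \<Rightarrow> 'm \<Rightarrow> 'm \<Rightarrow> bool" where
  "span_fib c d M a b \<longleftrightarrow> (\<exists>Q q1 q2 m. is_pullback C c d Q q1 q2 \<and> m \<in> hom C M Q \<and> m \<in> Fib C \<and>
     q1 \<cdot> m = a \<and> q2 \<cdot> m = b)"

lemma span_fib_sym: "span_fib c d M a b \<Longrightarrow> span_fib d c M b a"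
  unfolding span_fib_def using pullback_sym by blast

lemma span_fib_hom:
  assumes "span_fib c d M a b" "c \<in> hom C A I" "d \<in> hom C B I"
  shows "a \<in> hom C M A" "b \<in> hom C M B" "c \<cdot> a = d \<cdot> b"
proof -
  obtain Q q1 q2 m where Q: "is_pullback C c d Q q1 q2" and m: "m \<in> hom C M Q"
    and a: "q1 \<cdot> m = a" "q2 \<cdot> m = b"
    using assms(1) unfolding span_fib_def by blast
  have q: "q1 \<in> hom C Q A" "q2 \<in> hom C Q B" "c \<cdot> q1 = d \<cdot> q2"
    using pullbackD[OF Q assms(2)] homD(2)[OF assms(3)] by auto
  show "a \<in> hom C M A" "b \<in> hom C M B" using a comp_hom[OF m] q by auto
  show "c \<cdot> a = d \<cdot> b"
    using comp_assoc[OF m q(1) assms(2)] comp_assoc[OF m q(2) assms(3)] q a by simp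
qed

lemma span_fib_right_fib:
  assumes "span_fib c d M a b" "c \<in> Fib C"
  shows "b \<in> Fib C"
proof -
  obtain Q q1 q2 m where Q: "is_pullback C c d Q q1 q2" and m: "m \<in> hom C M Q" "m \<in> Fib C"
    and a: "q2 \<cdot> m = b"
    using assms(1) unfolding span_fib_def by blast
  have "q2 \<in> Fib C" using fib_pullback[OF assms(2) Q] .
  moreover have "q2 \<in> hom C Q (Dom C d)" using Q by (auto simp: is_pullback_def)
  ultimately show ?thesis using fib_comp_hom[OF m(1) _ m(2)] a by blast
qed

text \<open>The map \<open>l\<close> from \<open>N\<close> to the fibre product \<open>R\<close> of
  \<open>A\<close> and \<open>D\<close> is the pullback of \<open>m\<close> along k = 1 \<times> v,
  by pasting of pullbacks.\<close>

lemma span_fib_base_change: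
  assumes M: "span_fib c d M a b" and c: "c \<in> hom C A I" "c \<in> Fib C" and d: "d \<in> hom C B I"
    and v: "v \<in> hom C D B" and N: "is_pullback C b v N n1 n2"
  shows "span_fib c (d \<cdot> v) N (a \<cdot> n1) n2"
proof -
  obtain Q q1 q2 m where Q: "is_pullback C c d Q q1 q2" and m: "m \<in> hom C M Q" "m \<in> Fib C"
    and mq: "q1 \<cdot> m = a" "q2 \<cdot> m = b"
    using M unfolding span_fib_def by blast
  have q: "q1 \<in> hom C Q A" "q2 \<in> hom C Q B" "c \<cdot> q1 = d \<cdot> q2"
    using pullbackD[OF Q c(1)] homD(2)[OF d] by auto
  note ab = span_fib_hom[OF M c(1) d]
  have n: "n1 \<in> hom C N M" "n2 \<in> hom C N D" "b \<cdot> n1 = v \<cdot> n2"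
    using pullbackD[OF N ab(2)] homD(2)[OF v] by auto
  have dv: "d \<cdot> v \<in> hom C D I" using comp_hom[OF v d] .
  obtain R r1 r2 where R: "is_pullback C c (d \<cdot> v) R r1 r2"
    using pullback_ex[OF c(1) dv c(2)] by blast
  have r: "r1 \<in> hom C R A" "r2 \<in> hom C R D" "c \<cdot> r1 = (d \<cdot> v) \<cdot> r2"
    using pullbackD[OF R c(1)] homD(2)[OF dv] by auto
  obtain k where k: "k \<in> hom C R Q" "q1 \<cdot> k = r1" "q2 \<cdot> k = v \<cdot> r2"
    using pullback_pair_ex[OF Q c(1) d r(1) comp_hom[OF r(2) v]] r comp_assoc[OF r(2) v d] by auto
  have "c \<cdot> (a \<cdot> n1) = (d \<cdot> v) \<cdot> n2"
    using comp_assoc[OF n(1) ab(1) c(1)] comp_assoc[OF n(1) ab(2) d] comp_assoc[OF n(2) v d] ab n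
    by simp
  then obtain l where l: "l \<in> hom C N R" "r1 \<cdot> l = a \<cdot> n1" "r2 \<cdot> l = n2"
    using pullback_pair_ex[OF R c(1) dv comp_hom[OF n(1) ab(1)] n(2)] by auto
  have "is_pullback C m k N n1 l"
  proof (rule pullbackI[OF m(1) k(1) n(1) l(1)])
    show "m \<cdot> n1 = k \<cdot> l"
    proof (rule pullback_pair_eq[OF Q])
      show "m \<cdot> n1 \<in> hom C N Q" "k \<cdot> l \<in> hom C N Q"
        using comp_hom n m k l by blast+
      show "q1 \<cdot> (m \<cdot> n1) = q1 \<cdot> (k \<cdot> l)"
        using comp_assoc[OF n(1) m(1) q(1)] comp_assoc[OF l(1) k(1) q(1)] mq k l by simp
      show "q2 \<cdot> (m \<cdot> n1) = q2 \<cdot> (k \<cdot> l)"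
        using comp_assoc[OF n(1) m(1) q(2)] comp_assoc[OF l(1) k(1) q(2)] comp_assoc[OF l(1) r(2) v]
          mq k l n by simp
    qed
  next
    fix Z x y
    assume x: "x \<in> hom C Z M" and y: "y \<in> hom C Z R" and xy: "m \<cdot> x = k \<cdot> y"
    have ax: "a \<cdot> x = r1 \<cdot> y"
      using comp_assoc[OF x m(1) q(1)] comp_assoc[OF y k(1) q(1)] mq k xy by simp
    have "b \<cdot> x = v \<cdot> (r2 \<cdot> y)"
      using comp_assoc[OF x m(1) q(2)] comp_assoc[OF y k(1) q(2)] comp_assoc[OF y r(2) v] mq k xy
      by simp
    then obtain z where z: "z \<in> hom C Z N" "n1 \<cdot> z = x" "n2 \<cdot> z = r2 \<cdot> y"
      using pullback_pair_ex[OF N ab(2) v x comp_hom[OF y r(2)]] by auto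
    have "l \<cdot> z = y"
    proof (rule pullback_pair_eq[OF R comp_hom[OF z(1) l(1)] y])
      show "r1 \<cdot> (l \<cdot> z) = r1 \<cdot> y"
        using comp_assoc[OF z(1) l(1) r(1)] comp_assoc[OF z(1) n(1) ab(1)] l z ax by simp
      show "r2 \<cdot> (l \<cdot> z) = r2 \<cdot> y"
        using comp_assoc[OF z(1) l(1) r(2)] l z by simp
    qed
    with z show "\<exists>w \<in> hom C Z N. n1 \<cdot> w = x \<and> l \<cdot> w = y" by blast
  next
    fix Z w w'
    assume w: "w \<in> hom C Z N" "w' \<in> hom C Z N" "n1 \<cdot> w = n1 \<cdot> w'" "l \<cdot> w = l \<cdot> w'"
    have "n2 \<cdot> w = n2 \<cdot> w'"
      using comp_assoc[OF w(1) l(1) r(2)] comp_assoc[OF w(2) l(1) r(2)] l w by simp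
    with w show "w = w'" using pullback_pair_eq[OF N] by blast
  qed
  then have "l \<in> Fib C" using fib_pullback[OF m(2)] by blast
  with R l show ?thesis unfolding span_fib_def by blast
qed

lemma span_fib_base_change_left:
  assumes "span_fib c d M a b" "c \<in> hom C A I" "d \<in> hom C B I" "d \<in> Fib C"
    and "v \<in> hom C D A" "is_pullback C v a N n1 n2"
  shows "span_fib (c \<cdot> v) d N n1 (b \<cdot> n2)"
  using span_fib_base_change[OF span_fib_sym[OF assms(1)] assms(3,4,2,5) pullback_sym[OF assms(6)]]
  by (rule span_fib_sym)

text \<open>The induced map factors through the fibre product of \<open>M\<close> and
  \<open>D\<close> over \<open>B\<close>: the first factor is a fibration by the hypothesis on
  \<open>N\<close>, the second by \<open>span_fib_base_change\<close>.\<close>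

lemma span_fib_comp:
  assumes M: "span_fib c d M a b" and c: "c \<in> hom C A I" "c \<in> Fib C" and d: "d \<in> hom C B I"
    and v: "v \<in> hom C D B" and N: "span_fib b v N n1 n2"
  shows "span_fib c (d \<cdot> v) N (a \<cdot> n1) n2"
proof -
  note ab = span_fib_hom[OF M c(1) d]
  obtain Q q1 q2 m where Q: "is_pullback C b v Q q1 q2" and m: "m \<in> hom C N Q" "m \<in> Fib C"
    and mq: "q1 \<cdot> m = n1" "q2 \<cdot> m = n2"
    using N unfolding span_fib_def by blast
  have q: "q1 \<in> hom C Q M" using pullbackD[OF Q ab(2)] by auto
  obtain R r1 r2 l where R: "is_pullback C c (d \<cdot> v) R r1 r2" and l: "l \<in> hom C Q R" "l \<in> Fib C"
    "r1 \<cdot> l = a \<cdot> q1" "r2 \<cdot> l = q2"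
    using span_fib_base_change[OF M c d v Q] unfolding span_fib_def by blast
  have r: "r1 \<in> hom C R A" "r2 \<in> hom C R D"
    using pullbackD[OF R c(1)] homD(2)[OF comp_hom[OF v d]] by auto
  have "r1 \<cdot> (l \<cdot> m) = a \<cdot> n1" "r2 \<cdot> (l \<cdot> m) = n2"
    using comp_assoc[OF m(1) l(1) r(1)] comp_assoc[OF m(1) l(1) r(2)] comp_assoc[OF m(1) q ab(1)]
      l mq by simp_all
  with R comp_hom[OF m(1) l(1)] fib_comp_hom[OF m(1) l(1) m(2) l(2)] show ?thesis
    unfolding span_fib_def by blast
qed

text \<open>The map l = 1 \<times> k between the fibre products with \<open>E\<close> and with
  \<open>B\<close> is the pullback of \<open>k\<close> along the projection \<open>r2\<close>, hence
  a fibration; composing it with \<open>m\<close> gives the required map.\<close>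

lemma span_fib_postcomp:
  assumes M: "span_fib c (d \<cdot> k) M a b" and c: "c \<in> hom C A I" "c \<in> Fib C"
    and d: "d \<in> hom C B I" and k: "k \<in> hom C E B" "k \<in> Fib C"
  shows "span_fib c d M a (k \<cdot> b)"
proof -
  have dk: "d \<cdot> k \<in> hom C E I" using comp_hom[OF k(1) d] .
  obtain Q q1 q2 m where Q: "is_pullback C c (d \<cdot> k) Q q1 q2" and m: "m \<in> hom C M Q" "m \<in> Fib C"
    and mq: "q1 \<cdot> m = a" "q2 \<cdot> m = b"
    using M unfolding span_fib_def by blast
  have q: "q1 \<in> hom C Q A" "q2 \<in> hom C Q E" "c \<cdot> q1 = (d \<cdot> k) \<cdot> q2"
    using pullbackD[OF Q c(1)] homD(2)[OF dk] by auto
  obtain R r1 r2 where R: "is_pullback C c d R r1 r2"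
    using pullback_ex[OF c(1) d c(2)] by blast
  have r: "r1 \<in> hom C R A" "r2 \<in> hom C R B" "c \<cdot> r1 = d \<cdot> r2"
    using pullbackD[OF R c(1)] homD(2)[OF d] by auto
  obtain l where l: "l \<in> hom C Q R" "r1 \<cdot> l = q1" "r2 \<cdot> l = k \<cdot> q2"
    using pullback_pair_ex[OF R c(1) d q(1) comp_hom[OF q(2) k(1)]] q comp_assoc[OF q(2) k(1) d]
    by auto
  have "is_pullback C k r2 Q q2 l"
  proof (rule pullbackI[OF k(1) r(2) q(2) l(1)])
    show "k \<cdot> q2 = r2 \<cdot> l" using l by simp
  next
    fix Z x y
    assume x: "x \<in> hom C Z E" and y: "y \<in> hom C Z R" and xy: "k \<cdot> x = r2 \<cdot> y"
    have "c \<cdot> (r1 \<cdot> y) = (d \<cdot> k) \<cdot> x"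
      using comp_assoc[OF y r(1) c(1)] comp_assoc[OF y r(2) d] comp_assoc[OF x k(1) d] r xy by simp
    then obtain z where z: "z \<in> hom C Z Q" "q1 \<cdot> z = r1 \<cdot> y" "q2 \<cdot> z = x"
      using pullback_pair_ex[OF Q c(1) dk comp_hom[OF y r(1)] x] by auto
    have "l \<cdot> z = y"
    proof (rule pullback_pair_eq[OF R comp_hom[OF z(1) l(1)] y])
      show "r1 \<cdot> (l \<cdot> z) = r1 \<cdot> y"
        using comp_assoc[OF z(1) l(1) r(1)] l z by simp
      show "r2 \<cdot> (l \<cdot> z) = r2 \<cdot> y"
        using comp_assoc[OF z(1) l(1) r(2)] comp_assoc[OF z(1) q(2) k(1)] l z xy by simp
    qed
    with z show "\<exists>w \<in> hom C Z Q. q2 \<cdot> w = x \<and> l \<cdot> w = y" by blast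
  next
    fix Z w w'
    assume w: "w \<in> hom C Z Q" "w' \<in> hom C Z Q" "q2 \<cdot> w = q2 \<cdot> w'" "l \<cdot> w = l \<cdot> w'"
    have "q1 \<cdot> w = q1 \<cdot> w'"
      using comp_assoc[OF w(1) l(1) r(1)] comp_assoc[OF w(2) l(1) r(1)] l w by simp
    with w show "w = w'" using pullback_pair_eq[OF Q] by blast
  qed
  then have "l \<in> Fib C" using fib_pullback[OF k(2)] by blast
  moreover have "r1 \<cdot> (l \<cdot> m) = a" "r2 \<cdot> (l \<cdot> m) = k \<cdot> b"
    using comp_assoc[OF m(1) l(1) r(1)] comp_assoc[OF m(1) l(1) r(2)] comp_assoc[OF m(1) q(2) k(1)]
      l mq by simp_all
  ultimately show ?thesis
    using R comp_hom[OF m(1) l(1)] fib_comp_hom[OF m(1) l(1) m(2)]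
    unfolding span_fib_def by blast
qed

section \<open>Path objects and mapping path objects\<close>

lemma path_object_iff:
  assumes "is_terminal C T" "b \<in> hom C B T"
  shows "path_object C B P r s t \<longleftrightarrow> r \<in> hom C B P \<and> r \<in> Weq C \<and> s \<in> hom C P B \<and> t \<in> hom C P B \<and>
    s \<cdot> r = Idt C B \<and> t \<cdot> r = Idt C B \<and> span_fib b b P s t"
  unfolding path_object_def span_fib_def product_iff_pullback[OF assms assms(2)] by blast

lemma fibrant_terminal:
  obtains T where "is_terminal C T" "\<forall>A \<in> Obj C. \<exists>a. a \<in> hom C A T"
    "\<forall>A. hom C A T \<subseteq> Fib C"
proof -
  obtain T where T: "is_terminal C T" "\<forall>X \<in> Obj C. hom C X T \<subseteq> Fib C"
    using terminal_fib by (elim exE conjE)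
  have "\<forall>A \<in> Obj C. \<exists>a. a \<in> hom C A T"
    using T(1) unfolding is_terminal_def by (elim conjE) (blast dest: bspec)
  moreover have "\<forall>A. hom C A T \<subseteq> Fib C" using T(2) homD(4) by blast
  ultimately show thesis using T(1) that by simp
qed

text \<open>The map \<open>s\<close> is (s, t) followed by a product projection, which is a pullback
  of the fibration from \<open>B\<close> to the terminal object; and \<open>s\<close> is a
  retraction of the weak equivalence \<open>r\<close>.\<close>

lemma path_object_source_acyclic:
  assumes "path_object C B P r s t"
  shows "s \<in> Fib C" "s \<in> Weq C"
proof -
  have B: "B \<in> Obj C" using assms homD(4) unfolding path_object_def by blast
  obtain T where T: "is_terminal C T" "\<forall>A \<in> Obj C. \<exists>a. a \<in> hom C A T"
    "\<forall>A. hom C A T \<subseteq> Fib C"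
    by (rule fibrant_terminal)
  obtain b where b: "b \<in> hom C B T" "b \<in> Fib C" using T(2,3) B by blast
  show "s \<in> Fib C"
    using assms path_object_iff[OF T(1) b(1)] span_fib_right_fib[OF span_fib_sym] b by blast
  show "s \<in> Weq C"
    using assms retraction_weq[of r B P s] unfolding path_object_def by blast
qed

text \<open>Here \<open>p1\<close> is a pullback of the acyclic fibration \<open>s\<close>, and w is
  a section of it, hence a weak equivalence. The pair formed by \<open>p1\<close> and
  \<open>t \<cdot> p2\<close> is the base change of (s, t) along u \<times> 1, which makes its
  second component a fibration.\<close>

lemma mapping_path_object:
  assumes P: "path_object C B P r s t" and u: "u \<in> hom C A B" and M: "is_pullback C u s M p1 p2"
  shows "p1 \<in> hom C M A" "p2 \<in> hom C M P" "u \<cdot> p1 = s \<cdot> p2" "p1 \<in> Fib C" "p1 \<in> Weq C"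
    and "\<lbrakk>is_terminal C T; b \<in> hom C B T; b \<in> Fib C\<rbrakk> \<Longrightarrow> span_fib (b \<cdot> u) b M p1 (t \<cdot> p2)"
    and "t \<cdot> p2 \<in> hom C M B" "t \<cdot> p2 \<in> Fib C"
    and "w_map C u r M p1 p2 \<in> hom C A M" "w_map C u r M p1 p2 \<in> Weq C"
    and "p1 \<cdot> w_map C u r M p1 p2 = Idt C A" "p2 \<cdot> w_map C u r M p1 p2 = r \<cdot> u"
    and "(t \<cdot> p2) \<cdot> w_map C u r M p1 p2 = u"
proof -
  have r: "r \<in> hom C B P" and s: "s \<in> hom C P B" "s \<cdot> r = Idt C B"
    and t: "t \<in> hom C P B" "t \<cdot> r = Idt C B"
    using P unfolding path_object_def by auto
  show p: "p1 \<in> hom C M A" "p2 \<in> hom C M P" "u \<cdot> p1 = s \<cdot> p2"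
    using pullbackD[OF M u] homD(2)[OF s(1)] by auto
  show ap: "p1 \<in> Fib C" "p1 \<in> Weq C"
    using acyclic_fib_pullback[OF _ pullback_sym[OF M]] path_object_source_acyclic[OF P] by auto
  show span: "span_fib (b \<cdot> u) b M p1 (t \<cdot> p2)"
    if "is_terminal C T" "b \<in> hom C B T" "b \<in> Fib C" for T b
    using span_fib_base_change_left[OF _ that(2,2,3) u M] P path_object_iff[OF that(1,2)] by blast
  show tp: "t \<cdot> p2 \<in> hom C M B" using comp_hom[OF p(2) t(1)] .
  obtain T where T: "is_terminal C T" "\<forall>A \<in> Obj C. \<exists>a. a \<in> hom C A T"
    "\<forall>A. hom C A T \<subseteq> Fib C"
    by (rule fibrant_terminal)
  obtain b where b: "b \<in> hom C B T" "b \<in> Fib C" using T(2,3) homD(5)[OF u] by blast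
  have "b \<cdot> u \<in> Fib C" using T(3) comp_hom[OF u b(1)] by blast
  then show "t \<cdot> p2 \<in> Fib C" using span_fib_right_fib[OF span[OF T(1) b]] by blast
  \<comment> \<open>The compatibility condition under which w, the pair of the identity and
    \<open>r \<cdot> u\<close>, maps into the pullback.\<close>
  have "u \<cdot> Idt C A = s \<cdot> (r \<cdot> u)"
    using comp_assoc[OF u r s(1)] s id_left[OF u] id_right[OF u] by simp
  then have w: "w_map C u r M p1 p2 \<in> hom C A M" "p1 \<cdot> w_map C u r M p1 p2 = Idt C A"
    "p2 \<cdot> w_map C u r M p1 p2 = r \<cdot> u"
    unfolding w_map_def homD(2)[OF u]
    using pb_pair_props[OF M u s(1) id_hom comp_hom[OF u r]] homD(4)[OF u] by auto
  then show "w_map C u r M p1 p2 \<in> hom C A M" "p1 \<cdot> w_map C u r M p1 p2 = Idt C A"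
    "p2 \<cdot> w_map C u r M p1 p2 = r \<cdot> u" by auto
  show "w_map C u r M p1 p2 \<in> Weq C"
    using section_weq[OF w(1) p(1) w(2) ap(2)] .
  show "(t \<cdot> p2) \<cdot> w_map C u r M p1 p2 = u"
    using comp_assoc[OF w(1) p(2) t(1)] comp_assoc[OF u r t(1)] w t id_left[OF u] by simp
qed

text \<open>The factorisation goes through the mapping path object of \<open>u\<close>: w followed
  by the endpoint map.\<close>

lemma factorisation:
  assumes "u \<in> hom C A B"
  obtains E j e where "j \<in> hom C A E" "j \<in> Weq C" "e \<in> hom C E B" "e \<in> Fib C" "e \<cdot> j = u"
proof -
  obtain P r s t where P: "path_object C B P r s t"
    using path_object_ex homD(5)[OF assms] by blast
  have s: "s \<in> hom C P B" using P unfolding path_object_def by blast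
  obtain M p1 p2 where "is_pullback C u s M p1 p2"
    using pullback_ex[OF s assms] path_object_source_acyclic[OF P] pullback_sym by blast
  from mapping_path_object[OF P assms this] that show thesis by blast
qed

section \<open>The category of fibrations over a fixed object\<close>

lemma slice_simps:
  "Obj (slice C X) = {p \<in> Fib C. Cod C p = X}"
  "Idt (slice C X) p = (p, Idt C (Dom C p), p)"
  "Comp (slice C X) (p', v, q') (p, u, q) = (p, v \<cdot> u, q')"
  "(p, u, q) \<in> Fib (slice C X) \<longleftrightarrow> (p, u, q) \<in> slice_arr C X \<and> u \<in> Fib C"
  "(p, u, q) \<in> Weq (slice C X) \<longleftrightarrow> (p, u, q) \<in> slice_arr C X \<and> u \<in> Weq C"
  by (auto simp: slice_def)

lemma slice_hom_arr: "x \<in> hom (slice C X) p q \<longleftrightarrow> (\<exists>u. x = (p, u, q) \<and> (p, u, q) \<in> slice_arr C X)"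
  unfolding hom_def[of "slice C X"] by (cases x) (auto simp: slice_def)

lemma slice_hom_iff:
  "(p', u, q') \<in> hom (slice C X) p q \<longleftrightarrow> p' = p \<and> q' = q \<and> (p, u, q) \<in> slice_arr C X"
  by (auto simp: slice_hom_arr)

lemma slice_arrD:
  assumes "(p, u, q) \<in> slice_arr C X"
  shows "p \<in> Fib C" "q \<in> Fib C" "p \<in> hom C (Dom C p) X" "q \<in> hom C (Dom C q) X"
    "u \<in> hom C (Dom C p) (Dom C q)" "q \<cdot> u = p"
  using assms fib_arr by (auto simp: slice_arr_def hom_def)

lemma slice_arrI:
  assumes "p \<in> Fib C" "q \<in> Fib C" "p \<in> hom C A X" "q \<in> hom C B X" "u \<in> hom C A B" "q \<cdot> u = p"
  shows "(p, u, q) \<in> slice_arr C X"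
  using assms by (auto simp: slice_arr_def hom_def)

text \<open>Makes \<open>product_iso\<close> available in C(X).\<close>

lemma slice_category: "category (slice C X)"
proof
  fix f assume "f \<in> Arr (slice C X)"
  then show "Dom (slice C X) f \<in> Obj (slice C X)" "Cod (slice C X) f \<in> Obj (slice C X)"
    by (auto simp: slice_def slice_arr_def)
next
  fix A assume "A \<in> Obj (slice C X)"
  then have A: "A \<in> Fib C" "A \<in> hom C (Dom C A) X" using fib_arr by (auto simp: slice_simps hom_def)
  then show "Idt (slice C X) A \<in> hom (slice C X) A A"
    unfolding slice_simps slice_hom_iff
    using slice_arrI[OF A(1,1,2,2) id_hom id_right[OF A(2)]] homD(4)[OF A(2)] by blast
next
  fix A B D f g
  assume "f \<in> hom (slice C X) A B" "g \<in> hom (slice C X) B D"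
  then obtain u v where u: "f = (A, u, B)" "(A, u, B) \<in> slice_arr C X"
    and v: "g = (B, v, D)" "(B, v, D) \<in> slice_arr C X" by (auto simp: slice_hom_arr)
  note U = slice_arrD[OF u(2)] and V = slice_arrD[OF v(2)]
  have "D \<cdot> (v \<cdot> u) = A" using comp_assoc[OF U(5) V(5) V(4)] U V by simp
  then show "Comp (slice C X) g f \<in> hom (slice C X) A D"
    unfolding u(1) v(1) slice_simps slice_hom_iff
    using slice_arrI[OF U(1) V(2) U(3) V(4) comp_hom[OF U(5) V(5)]] by blast
next
  fix A B f assume "f \<in> hom (slice C X) A B"
  then obtain u where u: "f = (A, u, B)" "(A, u, B) \<in> slice_arr C X" by (auto simp: slice_hom_arr)
  note U = slice_arrD[OF u(2)]
  show "Comp (slice C X) (Idt (slice C X) B) f = f" "Comp (slice C X) f (Idt (slice C X) A) = f"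
    unfolding u(1) slice_simps using id_left[OF U(5)] id_right[OF U(5)] by auto
next
  fix A B D E f g h
  assume "f \<in> hom (slice C X) A B" "g \<in> hom (slice C X) B D" "h \<in> hom (slice C X) D E"
  then obtain u v w where u: "f = (A, u, B)" "(A, u, B) \<in> slice_arr C X"
    and v: "g = (B, v, D)" "(B, v, D) \<in> slice_arr C X"
    and w: "h = (D, w, E)" "(D, w, E) \<in> slice_arr C X" by (auto simp: slice_hom_arr)
  show "Comp (slice C X) (Comp (slice C X) h g) f = Comp (slice C X) h (Comp (slice C X) g f)"
    unfolding u(1) v(1) w(1) slice_simps
    using comp_assoc[OF slice_arrD(5)[OF u(2)] slice_arrD(5)[OF v(2)] slice_arrD(5)[OF w(2)]]
    by simp
qed

text \<open>The binary product of \<open>f\<close> with itself in C(X) is the fibre product over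
  \<open>X\<close>, with structure map \<open>f \<cdot> q1\<close>.\<close>

lemma slice_product:
  assumes f: "f \<in> hom C Y X" "f \<in> Fib C" and Q: "is_pullback C f f Q q1 q2"
  shows "is_product (slice C X) f f (f \<cdot> q1) (f \<cdot> q1, q1, f) (f \<cdot> q1, q2, f)"
    and "f \<cdot> q1 \<in> Fib C"
proof -
  have q: "q1 \<in> hom C Q Y" "q2 \<in> hom C Q Y" "f \<cdot> q1 = f \<cdot> q2"
    using pullbackD[OF Q f(1)] homD(2)[OF f(1)] by auto
  have c: "f \<cdot> q1 \<in> hom C Q X" using comp_hom[OF q(1) f(1)] .
  show F: "f \<cdot> q1 \<in> Fib C"
    using fib_comp_hom[OF q(2) f(1) fib_pullback[OF f(2) Q] f(2)] q by simp
  show "is_product (slice C X) f f (f \<cdot> q1) (f \<cdot> q1, q1, f) (f \<cdot> q1, q2, f)"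
    unfolding is_product_def
  proof (intro conjI allI ballI)
    show "(f \<cdot> q1, q1, f) \<in> hom (slice C X) (f \<cdot> q1) f" "(f \<cdot> q1, q2, f) \<in> hom (slice C X) (f \<cdot> q1) f"
      using slice_arrI[OF F f(2) c f(1)] q by (auto simp: slice_hom_iff)
  next
    fix z x y
    assume "x \<in> hom (slice C X) z f" "y \<in> hom (slice C X) z f"
    then obtain u v where x: "x = (z, u, f)" "(z, u, f) \<in> slice_arr C X"
      and y: "y = (z, v, f)" "(z, v, f) \<in> slice_arr C X" by (auto simp: slice_hom_arr)
    note U = slice_arrD[OF x(2), unfolded homD(2)[OF f(1)]]
      and V = slice_arrD[OF y(2), unfolded homD(2)[OF f(1)]]
    obtain w where w: "w \<in> hom C (Dom C z) Q" "q1 \<cdot> w = u" "q2 \<cdot> w = v"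
      using pullback_pair_ex[OF Q f(1,1) U(5) V(5)] U V by auto
    have "(f \<cdot> q1) \<cdot> w = z" using comp_assoc[OF w(1) q(1) f(1)] w U by simp
    then have zw: "(z, w, f \<cdot> q1) \<in> slice_arr C X" using slice_arrI[OF U(1) F U(3) c w(1)] by blast
    have uniq: "w' = w" if "(z, w', f \<cdot> q1) \<in> slice_arr C X" "q1 \<cdot> w' = u" "q2 \<cdot> w' = v" for w'
      using pullback_pair_eq[OF Q _ w(1)] slice_arrD(5)[OF that(1)] that w homD(2)[OF c] by simp
    show "\<exists>!w. w \<in> hom (slice C X) z (f \<cdot> q1) \<and>
        Comp (slice C X) (f \<cdot> q1, q1, f) w = x \<and> Comp (slice C X) (f \<cdot> q1, q2, f) w = y"
    proof (rule ex1I[of _ "(z, w, f \<cdot> q1)"])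
      show "(z, w, f \<cdot> q1) \<in> hom (slice C X) z (f \<cdot> q1) \<and>
          Comp (slice C X) (f \<cdot> q1, q1, f) (z, w, f \<cdot> q1) = x \<and>
          Comp (slice C X) (f \<cdot> q1, q2, f) (z, w, f \<cdot> q1) = y"
        using zw w by (simp add: x(1) y(1) slice_hom_iff slice_simps)
    next
      fix l
      assume l: "l \<in> hom (slice C X) z (f \<cdot> q1) \<and>
          Comp (slice C X) (f \<cdot> q1, q1, f) l = x \<and> Comp (slice C X) (f \<cdot> q1, q2, f) l = y"
      then obtain w' where "l = (z, w', f \<cdot> q1)" "(z, w', f \<cdot> q1) \<in> slice_arr C X"
        by (auto simp: slice_hom_arr)
      with l uniq[of w'] show "l = (z, w, f \<cdot> q1)" by (simp add: x(1) y(1) slice_simps)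
    qed
  qed
qed

text \<open>Together with \<open>slice_path_objectD\<close> this reduces path objects in C(X) to
  data in C. This direction supplies the path object for a homotopy that has to be
  constructed.\<close>

lemma slice_path_objectI:
  assumes f: "f \<in> hom C Y X" "f \<in> Fib C" and st: "span_fib f f P s t"
    and r: "r \<in> hom C Y P" "r \<in> Weq C" "s \<cdot> r = Idt C Y" "t \<cdot> r = Idt C Y"
  shows "path_object (slice C X) f (f \<cdot> s) (f, r, f \<cdot> s) (f \<cdot> s, s, f) (f \<cdot> s, t, f)"
proof -
  note S = span_fib_hom[OF st f(1,1)]
  have F: "f \<cdot> s \<in> Fib C"
    using fib_comp_hom[OF S(1) f(1) span_fib_right_fib[OF span_fib_sym[OF st] f(2)] f(2)] .
  have c: "f \<cdot> s \<in> hom C P X" using comp_hom[OF S(1) f(1)] .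
  have "(f \<cdot> s) \<cdot> r = f" using comp_assoc[OF r(1) S(1) f(1)] r id_right[OF f(1)] by simp
  then have R: "(f, r, f \<cdot> s) \<in> slice_arr C X" using slice_arrI[OF f(2) F f(1) c r(1)] by blast
  obtain Q q1 q2 m where Q: "is_pullback C f f Q q1 q2" and m: "m \<in> hom C P Q" "m \<in> Fib C"
    "q1 \<cdot> m = s" "q2 \<cdot> m = t"
    using st unfolding span_fib_def by blast
  have q: "q1 \<in> hom C Q Y" "q2 \<in> hom C Q Y" using pullbackD[OF Q f(1)] homD(2)[OF f(1)] by auto
  have "(f \<cdot> q1) \<cdot> m = f \<cdot> s" using comp_assoc[OF m(1) q(1) f(1)] m by simp
  then have ms: "(f \<cdot> s, m, f \<cdot> q1) \<in> slice_arr C X"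
    using slice_arrI[OF F slice_product(2)[OF f Q] c comp_hom[OF q(1) f(1)] m(1)] by blast
  show ?thesis
    unfolding path_object_def
  proof (intro conjI exI)
    show "is_product (slice C X) f f (f \<cdot> q1) (f \<cdot> q1, q1, f) (f \<cdot> q1, q2, f)"
      using slice_product(1)[OF f Q] .
    show "(f \<cdot> s, m, f \<cdot> q1) \<in> hom (slice C X) (f \<cdot> s) (f \<cdot> q1)" "(f \<cdot> s, m, f \<cdot> q1) \<in> Fib (slice C X)"
      using ms m by (auto simp: slice_hom_iff slice_simps)
    show "(f \<cdot> s, s, f) \<in> hom (slice C X) (f \<cdot> s) f" "(f \<cdot> s, t, f) \<in> hom (slice C X) (f \<cdot> s) f"
      using slice_arrI[OF F f(2) c f(1)] S by (auto simp: slice_hom_iff)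
    show "(f, r, f \<cdot> s) \<in> hom (slice C X) f (f \<cdot> s)" "(f, r, f \<cdot> s) \<in> Weq (slice C X)"
      using R r by (auto simp: slice_hom_iff slice_simps)
  qed (use m r homD(2)[OF f(1)] in \<open>auto simp: slice_simps\<close>)
qed

text \<open>This direction unpacks a given homotopy. The path object comes with an arbitrary product
  in C(X), so its endpoint map is first composed with the comparison isomorphism to the fibre
  product.\<close>

lemma slice_path_objectD:
  assumes f: "f \<in> hom C Y X" "f \<in> Fib C"
    and P: "path_object (slice C X) f p (f, r, p) (p, s, f) (p, t, f)"
  shows "r \<in> hom C Y (Dom C p)" "r \<in> Weq C" "s \<cdot> r = Idt C Y" "t \<cdot> r = Idt C Y"
    "span_fib f f (Dom C p) s t"
proof -
  have "(f, r, p) \<in> slice_arr C X"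
    using P unfolding path_object_def slice_hom_iff by blast
  then show "r \<in> hom C Y (Dom C p)" using slice_arrD(5) homD(2)[OF f(1)] by auto
  show "r \<in> Weq C" "s \<cdot> r = Idt C Y" "t \<cdot> r = Idt C Y"
    using P homD(2)[OF f(1)] unfolding path_object_def by (auto simp: slice_simps)
  interpret S: category "slice C X" by (rule slice_category)
  obtain Q' y1 y2 z where Q': "is_product (slice C X) f f Q' y1 y2"
    and z: "z \<in> hom (slice C X) p Q'" "z \<in> Fib (slice C X)"
      "Comp (slice C X) y1 z = (p, s, f)" "Comp (slice C X) y2 z = (p, t, f)"
    using P unfolding path_object_def by blast
  obtain Q q1 q2 where Q: "is_pullback C f f Q q1 q2" using pullback_ex[OF f(1,1,2)] by blast
  have q: "q1 \<in> hom C Q Y" "q2 \<in> hom C Q Y" using pullbackD[OF Q f(1)] homD(2)[OF f(1)] by auto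
  note PQ = slice_product[OF f Q]
  obtain x x' where x: "x \<in> hom (slice C X) Q' (f \<cdot> q1)" "x' \<in> hom (slice C X) (f \<cdot> q1) Q'"
    "Comp (slice C X) x' x = Idt (slice C X) Q'" "Comp (slice C X) x x' = Idt (slice C X) (f \<cdot> q1)"
    "Comp (slice C X) (f \<cdot> q1, q1, f) x = y1" "Comp (slice C X) (f \<cdot> q1, q2, f) x = y2"
    using S.product_iso[OF Q' PQ(1)] by blast
  obtain i where i: "x = (Q', i, f \<cdot> q1)" "(Q', i, f \<cdot> q1) \<in> slice_arr C X"
    using x(1) by (auto simp: slice_hom_arr)
  obtain j where j: "x' = (f \<cdot> q1, j, Q')" "(f \<cdot> q1, j, Q') \<in> slice_arr C X"
    using x(2) by (auto simp: slice_hom_arr)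
  obtain m where m: "z = (p, m, Q')" "(p, m, Q') \<in> slice_arr C X"
    using z(1) by (auto simp: slice_hom_arr)
  have dQ: "Dom C (f \<cdot> q1) = Q" using homD(2)[OF comp_hom[OF q(1) f(1)]] .
  have ih: "i \<in> hom C (Dom C Q') Q" using slice_arrD(5)[OF i(2)] dQ by simp
  have jh: "j \<in> hom C Q (Dom C Q')" using slice_arrD(5)[OF j(2)] dQ by simp
  have mh: "m \<in> hom C (Dom C p) (Dom C Q')" using slice_arrD(5)[OF m(2)] .
  \<comment> \<open>The arrow of C underlying an isomorphism of C(X) is an isomorphism, hence a
    fibration, so composing with it preserves fibrations.\<close>
  have "is_iso C i"
    using x(3,4) jh homD[OF ih] dQ unfolding is_iso_def i(1) j(1) slice_simps by auto
  then have "i \<in> Fib C" using iso_acyclic_fib by blast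
  moreover have "m \<in> Fib C" using z(2) m by (auto simp: slice_simps)
  ultimately have im: "i \<cdot> m \<in> Fib C" using fib_comp_hom[OF mh ih] by blast
  have "q1 \<cdot> (i \<cdot> m) = s" "q2 \<cdot> (i \<cdot> m) = t"
    using x(5,6) z(3,4) comp_assoc[OF mh ih q(1)] comp_assoc[OF mh ih q(2)]
    unfolding i(1) m(1) slice_simps by (auto simp: slice_simps)
  with Q im comp_hom[OF mh ih] show "span_fib f f (Dom C p) s t"
    unfolding span_fib_def by blast
qed

section \<open>Existence of transport structures\<close>

text \<open>
  Factor \<open>(1, w) : Y \<rightarrow> Y \<times>\<^sub>X M\<close> as a weak equivalence \<open>j\<close> and a fibration \<open>(k, q) : E \<rightarrow> Y \<times>\<^sub>X M\<close>. Both \<open>k\<close>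
  and \<open>q\<close> are acyclic fibrations, so \<open>E \<times>\<^sub>M E\<close> is a path object on \<open>Y\<close> in \<open>C(X)\<close>. If \<open>\<sigma>\<close> is a section
  of \<open>q\<close>, then \<open>(\<sigma> w, j)\<close> is a homotopy from \<open>k \<sigma> w\<close> to \<open>k j = 1\<close>.
\<close>

lemma weq_retraction_up_to_homotopy:
  assumes f: "f \<in> hom C Y X" "f \<in> Fib C" and g: "g \<in> hom C M X" "g \<in> Fib C"
    and w: "w \<in> hom C Y M" "w \<in> Weq C" "g \<cdot> w = f"
  shows "\<exists>\<Gamma> \<in> hom C M Y. f \<cdot> \<Gamma> = g \<and> fibrewise_homotopic C f (\<Gamma> \<cdot> w) (Idt C Y)"
proof -
  have Y: "Y \<in> Obj C" using homD(4)[OF f(1)] .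
  obtain B b1 b2 where B: "is_pullback C f g B b1 b2" using pullback_ex[OF f(1) g(1) f(2)] by blast
  have b: "b1 \<in> hom C B Y" "b2 \<in> hom C B M" "f \<cdot> b1 = g \<cdot> b2"
    using pullbackD[OF B f(1)] homD(2)[OF g(1)] by auto
  have bF: "b1 \<in> Fib C" "b2 \<in> Fib C"
    using fib_pullback[OF g(2) pullback_sym[OF B]] fib_pullback[OF f(2) B] by auto
  obtain u where u: "u \<in> hom C Y B" "b1 \<cdot> u = Idt C Y" "b2 \<cdot> u = w"
    using pullback_pair_ex[OF B f(1) g(1) id_hom[OF Y] w(1)] id_right[OF f(1)] w by auto
  obtain E j e where j: "j \<in> hom C Y E" "j \<in> Weq C" and e: "e \<in> hom C E B" "e \<in> Fib C" "e \<cdot> j = u"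
    by (rule factorisation[OF u(1)])
  define k where "k = b1 \<cdot> e"
  define q where "q = b2 \<cdot> e"
  have kh: "k \<in> hom C E Y" and qh: "q \<in> hom C E M"
    using comp_hom[OF e(1)] b unfolding k_def q_def by auto
  have kF: "k \<in> Fib C" and qF: "q \<in> Fib C"
    using fib_comp_hom[OF e(1) b(1) e(2) bF(1)] fib_comp_hom[OF e(1) b(2) e(2) bF(2)]
    unfolding k_def q_def .
  have kj: "k \<cdot> j = Idt C Y" and qj: "q \<cdot> j = w"
    using comp_assoc[OF j(1) e(1) b(1)] comp_assoc[OF j(1) e(1) b(2)] e u
    unfolding k_def q_def by simp_all
  have kW: "k \<in> Weq C" using retraction_weq[OF j(1) kh kj j(2)] .
  have qW: "q \<in> Weq C" using weq_cancel_right[OF j(1) qh] qj w j by simp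
  have E: "span_fib f g E k q" unfolding span_fib_def k_def q_def using B e by blast
  note fk = span_fib_hom(3)[OF E f(1) g(1)]
  obtain P \<pi>1 \<pi>2 where P: "is_pullback C q q P \<pi>1 \<pi>2" using pullback_ex[OF qh qh qF] by blast
  have \<pi>: "\<pi>1 \<in> hom C P E" "\<pi>2 \<in> hom C P E" "q \<cdot> \<pi>1 = q \<cdot> \<pi>2"
    using pullbackD[OF P qh] homD(2)[OF qh] by auto
  have \<pi>1W: "\<pi>1 \<in> Weq C" using acyclic_fib_pullback[OF _ pullback_sym[OF P]] qF qW by blast
  \<comment> \<open>Base change of (k, q) along \<open>q\<close> gives a fibration from
    \<open>P\<close> to the fibre product of \<open>Y\<close> and \<open>E\<close> over
    \<open>X\<close>. Since \<open>g \<cdot> q\<close> equals \<open>f \<cdot> k\<close>,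
    postcomposition with \<open>k\<close> turns the factor \<open>E\<close> into
    \<open>Y\<close>.\<close>
  have st: "span_fib f f P (k \<cdot> \<pi>1) (k \<cdot> \<pi>2)"
    using span_fib_postcomp[OF _ f f(1) kh kF] span_fib_base_change[OF E f g(1) qh P] fk by simp
  \<comment> \<open>Reflexivity is (j, j); it is a weak equivalence because \<open>\<pi>1\<close>
    and \<open>j\<close> are.\<close>
  obtain r where r: "r \<in> hom C Y P" "\<pi>1 \<cdot> r = j" "\<pi>2 \<cdot> r = j"
    using pullback_pair_ex[OF P qh qh j(1) j(1)] by auto
  have rW: "r \<in> Weq C" using weq_cancel_left[OF r(1) \<pi>(1)] r j \<pi>1W by simp
  have sr: "(k \<cdot> \<pi>1) \<cdot> r = Idt C Y" "(k \<cdot> \<pi>2) \<cdot> r = Idt C Y"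
    using comp_assoc[OF r(1) \<pi>(1) kh] comp_assoc[OF r(1) \<pi>(2) kh] r kj by simp_all
  note PO = slice_path_objectI[OF f st r(1) rW sr]
  obtain \<sigma> where \<sigma>: "\<sigma> \<in> hom C M E" "q \<cdot> \<sigma> = Idt C M"
    using acyclic_fib_section[of q] qF qW homD[OF qh] by auto
  have \<sigma>w: "\<sigma> \<cdot> w \<in> hom C Y E" using comp_hom[OF w(1) \<sigma>(1)] .
  have "q \<cdot> (\<sigma> \<cdot> w) = q \<cdot> j"
    using comp_assoc[OF w(1) \<sigma>(1) qh] \<sigma> qj id_left[OF w(1)] by simp
  then obtain h where h: "h \<in> hom C Y P" "\<pi>1 \<cdot> h = \<sigma> \<cdot> w" "\<pi>2 \<cdot> h = j"
    using pullback_pair_ex[OF P qh qh \<sigma>w j(1)] by auto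
  have k\<sigma>: "k \<cdot> \<sigma> \<in> hom C M Y" using comp_hom[OF \<sigma>(1) kh] .
  have sh: "(k \<cdot> \<pi>1) \<cdot> h = (k \<cdot> \<sigma>) \<cdot> w" "(k \<cdot> \<pi>2) \<cdot> h = Idt C Y"
    using comp_assoc[OF h(1) \<pi>(1) kh] comp_assoc[OF h(1) \<pi>(2) kh] comp_assoc[OF w(1) \<sigma>(1) kh] h kj
    by simp_all
  have fg: "f \<cdot> (k \<cdot> \<sigma>) = g"
    using comp_assoc[OF \<sigma>(1) kh f(1)] comp_assoc[OF \<sigma>(1) qh g(1)] fk \<sigma> id_right[OF g(1)] by simp
  have k\<sigma>w: "(k \<cdot> \<sigma>) \<cdot> w \<in> hom C Y Y" using comp_hom[OF w(1) k\<sigma>] .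
  have "f \<cdot> ((k \<cdot> \<sigma>) \<cdot> w) = f \<cdot> Idt C Y"
    using comp_assoc[OF w(1) k\<sigma> f(1)] fg w id_right[OF f(1)] by simp
  moreover have "Dom C (f \<cdot> (k \<cdot> \<pi>1)) = P" "Dom C ((k \<cdot> \<sigma>) \<cdot> w) = Y"
    using homD(2)[OF comp_hom[OF comp_hom[OF \<pi>(1) kh] f(1)]] homD(2)[OF k\<sigma>w] by auto
  ultimately have "fibrewise_homotopic C f ((k \<cdot> \<sigma>) \<cdot> w) (Idt C Y)"
    unfolding fibrewise_homotopic_def homD(2)[OF f(1)] homD(3)[OF f(1)]
    using f(2) k\<sigma>w id_hom[OF Y] PO h(1) sh by fastforce
  with k\<sigma> fg show ?thesis by blast
qed

text \<open>The weak equivalence to be inverted is w from \<open>Y\<close> to \<open>M\<close>, with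
  \<open>M\<close> a fibration over \<open>X\<close> by its endpoint map.\<close>

lemma transport_structure_ex:
  assumes f: "f \<in> hom C Y X" "f \<in> Fib C" and P: "path_object C X PX rX sX tX"
    and M: "is_pullback C f sX M p1 p2"
  shows "\<exists>\<Gamma>. transport_structure C f rX tX M p1 p2 \<Gamma>"
proof -
  note m = mapping_path_object[OF P f(1) M]
  show ?thesis
    using weq_retraction_up_to_homotopy[OF f m(7-10) m(13)]
    unfolding transport_structure_def p_map_def homD(2)[OF f(1)] by blast
qed

section \<open>From a transport structure to a connection\<close>

text \<open>
  \<open>PY\<close> is the pullback of \<open>\<Gamma>\<close> and the source map of \<open>P\<^sub>X(Y)\<close>: a path from \<open>y\<close> to \<open>y'\<close> is a path
  \<open>\<pi>\<close> in \<open>X\<close> starting at \<open>f y\<close> with a fibrewise path from \<open>\<Gamma>(y, \<pi>)\<close> to \<open>y'\<close>.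
\<close>

lemma connection_of_transport:
  assumes f: "f \<in> hom C Y X" "f \<in> Fib C" and P: "path_object C X PX rX sX tX"
    and M: "is_pullback C f sX M p1 p2" and G: "transport_structure C f rX tX M p1 p2 \<Gamma>"
  shows "\<exists>PY rY sY tY Pf N.
    is_connection C f PX rX sX tX M p1 p2 PY rY sY tY Pf N \<and> tY \<cdot> N = \<Gamma>"
proof -
  note m = mapping_path_object[OF P f(1) M]
  have sX: "sX \<in> hom C PX X" and tX: "tX \<in> hom C PX X"
    using P unfolding path_object_def by auto
  define w where "w = w_map C f rX M p1 p2"
  have \<Gamma>: "\<Gamma> \<in> hom C M Y" "f \<cdot> \<Gamma> = tX \<cdot> p2"
    and H: "fibrewise_homotopic C f (\<Gamma> \<cdot> w) (Idt C Y)"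
    using G homD(2)[OF f(1)] unfolding transport_structure_def p_map_def w_def by auto
  have w: "w \<in> hom C Y M" "p1 \<cdot> w = Idt C Y" "p2 \<cdot> w = rX \<cdot> f" using m unfolding w_def by auto
  have \<Gamma>w: "\<Gamma> \<cdot> w \<in> hom C Y Y" using comp_hom[OF w(1) \<Gamma>(1)] .
  obtain p r s t h where PO: "path_object (slice C X) f p (f, r, p) (p, s, f) (p, t, f)"
    and h: "h \<in> hom C Y (Dom C p)" "s \<cdot> h = \<Gamma> \<cdot> w" "t \<cdot> h = Idt C Y"
    using H homD(3)[OF f(1)] homD(2)[OF \<Gamma>w] unfolding fibrewise_homotopic_def by auto
  define R where "R = Dom C p"
  note R = slice_path_objectD[OF f PO, folded R_def]
  note h = h[folded R_def]
  note S = span_fib_hom[OF R(5) f(1,1)]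
  have sF: "s \<in> Fib C" using span_fib_right_fib[OF span_fib_sym[OF R(5)] f(2)] .
  have sW: "s \<in> Weq C" using retraction_weq[OF R(1) S(1) R(3,2)] .
  obtain PY \<pi>1 \<pi>2 where PY: "is_pullback C \<Gamma> s PY \<pi>1 \<pi>2"
    using pullback_ex[OF S(1) \<Gamma>(1) sF] pullback_sym by blast
  have \<pi>: "\<pi>1 \<in> hom C PY M" "\<pi>2 \<in> hom C PY R" "\<Gamma> \<cdot> \<pi>1 = s \<cdot> \<pi>2"
    using pullbackD[OF PY \<Gamma>(1)] homD(2)[OF S(1)] by auto
  have \<pi>1: "\<pi>1 \<in> Fib C" "\<pi>1 \<in> Weq C"
    using acyclic_fib_pullback[OF _ pullback_sym[OF PY]] sF sW by auto
  \<comment> \<open>The pair (w, h). As \<Gamma> w is only homotopic to the identity, the fibrewise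
    component has to be the homotopy h rather than a constant path; it ends at the identity, so
    \<open>tY\<close> retracts \<open>rY\<close>.\<close>
  obtain rY where rY: "rY \<in> hom C Y PY" "\<pi>1 \<cdot> rY = w" "\<pi>2 \<cdot> rY = h"
    using pullback_pair_ex[OF PY \<Gamma>(1) S(1) w(1) h(1)] h by auto
  have "\<Gamma> \<cdot> Idt C M = s \<cdot> (r \<cdot> \<Gamma>)"
    using comp_assoc[OF \<Gamma>(1) R(1) S(1)] R id_left[OF \<Gamma>(1)] id_right[OF \<Gamma>(1)] by simp
  \<comment> \<open>The connection (1, r \<Gamma>): transport, followed by the constant fibrewise
    path.\<close>
  then obtain N where N: "N \<in> hom C M PY" "\<pi>1 \<cdot> N = Idt C M" "\<pi>2 \<cdot> N = r \<cdot> \<Gamma>"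
    using pullback_pair_ex[OF PY \<Gamma>(1) S(1) id_hom comp_hom[OF \<Gamma>(1) R(1)]] homD(4)[OF \<Gamma>(1)] by auto
  have sY: "p1 \<cdot> \<pi>1 \<in> hom C PY Y" "p1 \<cdot> \<pi>1 \<in> Weq C"
    using comp_hom[OF \<pi>(1) m(1)] weq_comp[OF \<pi>(1) m(1) \<pi>1(2) m(5)] by auto
  have tY: "t \<cdot> \<pi>2 \<in> hom C PY Y" using comp_hom[OF \<pi>(2) S(2)] .
  have sr: "(p1 \<cdot> \<pi>1) \<cdot> rY = Idt C Y" "(t \<cdot> \<pi>2) \<cdot> rY = Idt C Y"
    using comp_assoc[OF rY(1) \<pi>(1) m(1)] comp_assoc[OF rY(1) \<pi>(2) S(2)] rY w h by simp_all
  obtain T where T: "is_terminal C T" "\<forall>A \<in> Obj C. \<exists>a. a \<in> hom C A T"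
    "\<forall>A. hom C A T \<subseteq> Fib C"
    by (rule fibrant_terminal)
  obtain b where b: "b \<in> hom C X T" "b \<in> Fib C" using T(2,3) homD(5)[OF f(1)] by blast
  have bf: "b \<cdot> f \<in> hom C Y T" "b \<cdot> f \<in> Fib C"
    using comp_hom[OF f(1) b(1)] fib_comp_hom[OF f(1) b(1) f(2) b(2)] by auto
  \<comment> \<open>The base change of the fibrewise endpoint map along \<Gamma>. Because
    \<open>f \<cdot> \<Gamma>\<close> is the endpoint map of \<open>M\<close>, it composes with the
    fibration from \<open>M\<close> to Y \<times> X to give one from \<open>PY\<close> to Y \<times>
    Y.\<close>
  have "span_fib (f \<cdot> \<Gamma>) f PY \<pi>1 (t \<cdot> \<pi>2)"
    using span_fib_base_change_left[OF R(5) f(1,1,2) \<Gamma>(1) PY] .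
  then have "span_fib (b \<cdot> f) (b \<cdot> f) PY (p1 \<cdot> \<pi>1) (t \<cdot> \<pi>2)"
    using span_fib_comp[OF m(6)[OF T(1) b] bf b(1) f(1)] \<Gamma>(2) by simp
  then have "path_object C Y PY rY (p1 \<cdot> \<pi>1) (t \<cdot> \<pi>2)"
    using path_object_iff[OF T(1) bf(1)] rY sY tY sr section_weq[OF rY(1) sY(1) sr(1) sY(2)] by blast
  moreover have "p2 \<cdot> \<pi>1 \<in> hom C PY PX" using comp_hom[OF \<pi>(1) m(2)] .
  moreover have "p2 \<cdot> \<pi>1 \<in> Fib C"
    using fib_comp_hom[OF \<pi>(1) m(2) \<pi>1(1) fib_pullback[OF f(2) M]] .
  moreover have "(p2 \<cdot> \<pi>1) \<cdot> rY = rX \<cdot> f" using comp_assoc[OF rY(1) \<pi>(1) m(2)] rY w by simp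
  moreover have "sX \<cdot> (p2 \<cdot> \<pi>1) = f \<cdot> (p1 \<cdot> \<pi>1)"
    using comp_assoc[OF \<pi>(1) m(2) sX] comp_assoc[OF \<pi>(1) m(1) f(1)] m(3) by simp
  \<comment> \<open>A fibrewise path has both endpoints over the same point of \<open>X\<close>, and
    its source is the transported point, which lies over the end of the path in
    \<open>X\<close>.\<close>
  moreover have "tX \<cdot> (p2 \<cdot> \<pi>1) = f \<cdot> (t \<cdot> \<pi>2)"
    using comp_assoc[OF \<pi>(1) m(2) tX] comp_assoc[OF \<pi>(1) \<Gamma>(1) f(1)] comp_assoc[OF \<pi>(2) S(1) f(1)]
      comp_assoc[OF \<pi>(2) S(2) f(1)] S(3) \<Gamma>(2) \<pi>(3) by simp
  moreover have "(p2 \<cdot> \<pi>1) \<cdot> N = p2" "(p1 \<cdot> \<pi>1) \<cdot> N = p1"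
    using comp_assoc[OF N(1) \<pi>(1) m(2)] comp_assoc[OF N(1) \<pi>(1) m(1)] N id_right[OF m(1)]
      id_right[OF m(2)] by simp_all
  moreover have "(t \<cdot> \<pi>2) \<cdot> N = \<Gamma>"
    using comp_assoc[OF N(1) \<pi>(2) S(2)] comp_assoc[OF \<Gamma>(1) R(1) S(2)] N R id_left[OF \<Gamma>(1)] by simp
  ultimately show ?thesis
    unfolding is_connection_def homD(2)[OF f(1)] using N(1) by blast
qed

end

theorem theorem2p28:
  fixes C :: "('o, 'm) path_cat_data"
  assumes "path_category C"
  shows "(\<forall>X Y f PX rX sX tX M p1 p2 \<Gamma>.
            f \<in> hom C Y X \<and> f \<in> Fib C \<and> path_object C X PX rX sX tX \<and>
            is_pullback C f sX M p1 p2 \<and> transport_structure C f rX tX M p1 p2 \<Gamma> \<longrightarrow>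
            (\<exists>PY rY sY tY Pf N.
               is_connection C f PX rX sX tX M p1 p2 PY rY sY tY Pf N \<and> tY \<cdot>\<^bsub>C\<^esub> N = \<Gamma>))
       \<and> (\<forall>X Y f PX rX sX tX M p1 p2.
            f \<in> hom C Y X \<and> f \<in> Fib C \<and> path_object C X PX rX sX tX \<and>
            is_pullback C f sX M p1 p2 \<longrightarrow>
            (\<exists>PY rY sY tY Pf N.
               is_connection C f PX rX sX tX M p1 p2 PY rY sY tY Pf N))"
proof -
  interpret path_category C by fact
  show ?thesis
    using connection_of_transport transport_structure_ex by (metis (no_types, lifting))
qed

end
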